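(* Let $k\ge1$ and let $(\mathbb{N}_1,\ldots,\mathbb{N}_t)$ be a set partition of $\mathbb{N}$. Then $$A_k=1+\sum_{j=1}^k\gamma_j\prod_{i=j+1}^k(1-\alpha_i),$$ where for $i\in\mathbb{N}_m$, $\gamma_i=\frac{q_my_m}{1-q_m(z_m-y_m)}A_k+\frac{q_m(1-y_m)}{1-q_m(z_m-y_m)}$ and $\alpha_i=\frac{q_m(y_m-x_m)}{1-q_m(z_m-y_m)}$. Consequently $$A_k=\frac{1+\sum_{j=1}^{k}\frac{q_j(1-y_j)}{1-q_j(z_j-y_j)}\prod_{i=j+1}^{k}\frac{1-q_i(z_i-x_i)}{1-q_i(z_i-y_i)}}{1-\sum_{j=1}^{k}\frac{q_jy_j}{1-q_j(z_j-y_j)}\prod_{i=j+1}^{k}\frac{1-q_i(z_i-x_i)}{1-q_i(z_i-y_i)}},$$ where for each letter $a\in\{x,y,z,q\}$ and each $i\in[k]$, $a_i$ denotes $a_m$ for the unique $m$ with $i\in\mathbb{N}_m$.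
   Context: $[k]=\{1,\ldots,k\}$. For a word $\pi=\pi_1\cdots\pi_n$ over $[k]$ and $X\subseteq\mathbb{N}$, let $\overleftarrow{\mathrm{des}}_X(\pi)=|\{i:\pi_i>\pi_{i+1},\ \pi_i\in X\}|$, $\overleftarrow{\mathrm{ris}}_X(\pi)=|\{i:\pi_i<\pi_{i+1},\ \pi_i\in X\}|$, $\mathrm{lev}_X(\pi)=|\{i:\pi_i=\pi_{i+1},\ \pi_i\in X\}|$, and let $c_m(\pi)$ be the number of letters of $\pi$ lying in $\mathbb{N}_m$. Define the formal power series in the variables $x_m,y_m,z_m,q_m$ ($1\le m\le t$) $$A_k=\sum_{\pi}\prod_{m=1}^{t}x_m^{\overleftarrow{\mathrm{des}}_{\mathbb{N}_m}(\pi)}y_m^{\overleftarrow{\mathrm{ris}}_{\mathbb{N}_m}(\pi)}z_m^{\mathrm{lev}_{\mathbb{N}_m}(\pi)}q_m^{c_m(\pi)},$$ the sum over all words over $[k]$ of all lengths $n\ge0$ (including the empty word). Empty products equal $1$; quotients are taken in the ring of formal power series. *)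

theory Defs
  imports Complex_Main "HOL-Library.Poly_Mapping" "HOL-Library.Disjoint_Sets"
begin

section \<open>Formal power series in several variables\<close>

text \<open>
  A series in variables of type \<^typ>\<open>'v\<close> is an arbitrary family of coefficients indexed by the
  monomials, i.e. by the finitely supported exponent vectors \<^typ>\<open>'v \<Rightarrow>\<^sub>0 nat\<close>.
\<close>

typedef ('v, 'a) mps = "UNIV :: (('v \<Rightarrow>\<^sub>0 nat) \<Rightarrow> 'a) set"
  morphisms mps_coeff Abs_mps
  by simp

lemma mps_coeff_Abs [simp]: "mps_coeff (Abs_mps f) = f"
  by (simp add: Abs_mps_inverse)

lemma mps_eqI: "(\<And>m. mps_coeff f m = mps_coeff g m) \<Longrightarrow> f = g"
  by (metis mps_coeff_inject ext)

definition mono_splits :: "('v \<Rightarrow>\<^sub>0 nat) \<Rightarrow> (('v \<Rightarrow>\<^sub>0 nat) \<times> ('v \<Rightarrow>\<^sub>0 nat)) set" where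
  "mono_splits m = {(a, b). a + b = m}"

lemma finite_mono_splits [simp]: "finite (mono_splits m)"
proof -
  let ?B = "{f. \<forall>v. (v \<in> Poly_Mapping.keys m \<longrightarrow> f v \<in> {..Max (range (Poly_Mapping.lookup m))}) \<and>
               (v \<notin> Poly_Mapping.keys m \<longrightarrow> f v = (0::nat))}"
  let ?D = "{a. \<exists>b. a + b = m}"
  have fr: "finite (range (Poly_Mapping.lookup m))"
  proof -
    have "range (Poly_Mapping.lookup m) \<subseteq> insert 0 (Poly_Mapping.lookup m ` Poly_Mapping.keys m)"
      by (auto simp: in_keys_iff)
    then show ?thesis by (rule finite_subset) simp
  qed
  have "Poly_Mapping.lookup ` ?D \<subseteq> ?B"
  proof clarify
    fix a b v assume m: "m = a + b"
    have le: "Poly_Mapping.lookup a v \<le> Poly_Mapping.lookup (a + b) v"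
      by (simp add: lookup_add)
    have "Poly_Mapping.lookup (a + b) v \<le> Max (range (Poly_Mapping.lookup (a + b)))"
      using fr m by (intro Max_ge) auto
    with le show "(v \<in> Poly_Mapping.keys (a + b) \<longrightarrow>
        Poly_Mapping.lookup a v \<in> {..Max (range (Poly_Mapping.lookup (a + b)))}) \<and>
        (v \<notin> Poly_Mapping.keys (a + b) \<longrightarrow> Poly_Mapping.lookup a v = 0)"
      by (auto simp: in_keys_iff)
  qed
  moreover have "finite ?B"
    by (rule finite_set_of_finite_funs) auto
  ultimately have "finite (Poly_Mapping.lookup ` ?D)"
    by (rule finite_subset)
  then have fD: "finite ?D"
    by (rule finite_imageD) (auto simp: inj_on_def poly_mapping_eqI)
  have "mono_splits m \<subseteq> ?D \<times> ?D"
    by (auto simp: mono_splits_def) (metis add.commute)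
  then show ?thesis
    by (rule finite_subset) (intro finite_cartesian_product fD)
qed

lemma mono_splits_0 [simp]: "mono_splits 0 = {(0, 0)}"
proof -
  have "a = 0 \<and> b = 0" if "a + b = 0" for a b :: "'v \<Rightarrow>\<^sub>0 nat"
  proof -
    have "Poly_Mapping.lookup a v + Poly_Mapping.lookup b v = 0" for v
      using that by (metis lookup_add lookup_zero)
    then show ?thesis by (auto intro!: poly_mapping_eqI)
  qed
  then show ?thesis by (auto simp: mono_splits_def)
qed

instantiation mps :: (type, comm_ring_1) comm_ring_1
begin

definition zero_mps :: "('a, 'b) mps" where
  "0 = Abs_mps (\<lambda>m. 0)"

definition one_mps :: "('a, 'b) mps" where
  "1 = Abs_mps (\<lambda>m. if m = 0 then 1 else 0)"

definition plus_mps :: "('a, 'b) mps \<Rightarrow> ('a, 'b) mps \<Rightarrow> ('a, 'b) mps" where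
  "f + g = Abs_mps (\<lambda>m. mps_coeff f m + mps_coeff g m)"

definition uminus_mps :: "('a, 'b) mps \<Rightarrow> ('a, 'b) mps" where
  "- f = Abs_mps (\<lambda>m. - mps_coeff f m)"

definition minus_mps :: "('a, 'b) mps \<Rightarrow> ('a, 'b) mps \<Rightarrow> ('a, 'b) mps" where
  "f - g = Abs_mps (\<lambda>m. mps_coeff f m - mps_coeff g m)"

definition times_mps :: "('a, 'b) mps \<Rightarrow> ('a, 'b) mps \<Rightarrow> ('a, 'b) mps" where
  "f * g = Abs_mps (\<lambda>m. \<Sum>(a, b)\<in>mono_splits m. mps_coeff f a * mps_coeff g b)"

instance
proof
  fix f g h :: "('a, 'b) mps"
  show "f * g * h = f * (g * h)"
  proof (rule mps_eqI)
    fix m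
    have "mps_coeff (f * g * h) m =
        (\<Sum>p\<in>mono_splits m. \<Sum>q\<in>mono_splits (fst p).
           mps_coeff f (fst q) * mps_coeff g (snd q) * mps_coeff h (snd p))"
      by (simp add: times_mps_def case_prod_beta sum_distrib_right)
    also have "\<dots> = (\<Sum>r\<in>Sigma (mono_splits m) (\<lambda>p. mono_splits (fst p)).
           mps_coeff f (fst (snd r)) * mps_coeff g (snd (snd r)) * mps_coeff h (snd (fst r)))"
      by (subst sum.Sigma) (auto simp: case_prod_beta)
    also have "\<dots> = (\<Sum>r\<in>Sigma (mono_splits m) (\<lambda>p. mono_splits (snd p)).
           mps_coeff f (fst (fst r)) * (mps_coeff g (fst (snd r)) * mps_coeff h (snd (snd r))))"
      by (rule sum.reindex_bij_witness
            [where i = "\<lambda>((a, s), (b, c)). ((a + b, c), (a, b))"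
               and j = "\<lambda>((s, c), (a, b)). ((a, b + c), (b, c))"])
         (auto simp: mono_splits_def add.assoc mult.assoc)
    also have "\<dots> = (\<Sum>p\<in>mono_splits m. \<Sum>q\<in>mono_splits (snd p).
           mps_coeff f (fst p) * (mps_coeff g (fst q) * mps_coeff h (snd q)))"
      by (subst sum.Sigma) (auto simp: case_prod_beta)
    also have "\<dots> = mps_coeff (f * (g * h)) m"
      by (simp add: times_mps_def case_prod_beta sum_distrib_left)
    finally show "mps_coeff (f * g * h) m = mps_coeff (f * (g * h)) m" .
  qed
  show "f * g = g * f"
  proof (rule mps_eqI)
    fix m
    show "mps_coeff (f * g) m = mps_coeff (g * f) m"
      unfolding times_mps_def mps_coeff_Abs
      by (rule sum.reindex_bij_witness[where i = prod.swap and j = prod.swap])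
         (auto simp: mono_splits_def ac_simps)
  qed
  show "1 * f = f"
  proof (rule mps_eqI)
    fix m
    have "mps_coeff (1 * f) m =
        (\<Sum>p\<in>mono_splits m. if p = (0, m) then mps_coeff f m else 0)"
      unfolding times_mps_def one_mps_def mps_coeff_Abs
      by (rule sum.cong) (auto simp: mono_splits_def split: if_splits)
    also have "\<dots> = mps_coeff f m"
      by (subst sum.delta[OF finite_mono_splits]) (simp add: mono_splits_def)
    finally show "mps_coeff (1 * f) m = mps_coeff f m" .
  qed
  show "(f + g) * h = f * h + g * h"
    by (rule mps_eqI)
       (simp add: times_mps_def plus_mps_def case_prod_beta distrib_right sum.distrib)
  show "(0::('a, 'b) mps) \<noteq> 1"
  proof
    assume "(0::('a, 'b) mps) = 1"
    then have "mps_coeff (0::('a, 'b) mps) 0 = mps_coeff 1 0" by simp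
    then show False by (simp add: zero_mps_def one_mps_def)
  qed
qed (rule mps_eqI, simp add: plus_mps_def zero_mps_def uminus_mps_def minus_mps_def ac_simps)+

end

text \<open>
  Division is only meaningful when the divisor is a unit of the ring; the inverse of a non-unit is
  set to 0.
\<close>

instantiation mps :: (type, comm_ring_1) inverse
begin

definition inverse_mps :: "('a, 'b) mps \<Rightarrow> ('a, 'b) mps" where
  "inverse (f :: ('a, 'b) mps) = (if f dvd 1 then (THE g. f * g = 1) else 0)"

definition divide_mps :: "('a, 'b) mps \<Rightarrow> ('a, 'b) mps \<Rightarrow> ('a, 'b) mps" where
  "f div g = f * inverse (g :: ('a, 'b) mps)"

instance ..

end

definition mps_var :: "'v \<Rightarrow> ('v, 'a::comm_ring_1) mps" where
  "mps_var v = Abs_mps (\<lambda>m. if m = Poly_Mapping.single v 1 then 1 else 0)"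

text \<open>
  The formal sum of a family of series, taken coefficientwise; it is meaningful when, for every
  monomial, only finitely many members of the family have a nonzero coefficient.
\<close>

definition mps_summable :: "('i \<Rightarrow> ('v, 'a::comm_ring_1) mps) \<Rightarrow> 'i set \<Rightarrow> bool" where
  "mps_summable f I \<longleftrightarrow> (\<forall>m. finite {i \<in> I. mps_coeff (f i) m \<noteq> 0})"

definition mps_suminf :: "('i \<Rightarrow> ('v, 'a::comm_ring_1) mps) \<Rightarrow> 'i set \<Rightarrow> ('v, 'a) mps" where
  "mps_suminf f I = Abs_mps (\<lambda>m. \<Sum>i | i \<in> I \<and> mps_coeff (f i) m \<noteq> 0. mps_coeff (f i) m)"

lemma mps_coeff_simps [simp]:
  "mps_coeff 0 m = 0"
  "mps_coeff 1 m = (if m = 0 then 1 else 0)"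
  "mps_coeff (f + g) m = mps_coeff f m + mps_coeff g m"
  "mps_coeff (- f) m = - mps_coeff f m"
  "mps_coeff (f - g) m = mps_coeff f m - mps_coeff g m"
  by (simp_all add: zero_mps_def one_mps_def plus_mps_def uminus_mps_def minus_mps_def)

lemma mps_coeff_mult:
  "mps_coeff (f * g) m = (\<Sum>(a, b)\<in>mono_splits m. mps_coeff f a * mps_coeff g b)"
  by (simp add: times_mps_def)

lemma mps_coeff_0_mult [simp]: "mps_coeff (f * g) 0 = mps_coeff f 0 * mps_coeff g 0"
  by (simp add: mps_coeff_mult)

lemma mps_coeff_0_var [simp]: "mps_coeff (mps_var v) 0 = 0"
proof -
  have "Poly_Mapping.lookup (Poly_Mapping.single v (1::nat)) v \<noteq> Poly_Mapping.lookup 0 v"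
    by simp
  then have "Poly_Mapping.single v (1::nat) \<noteq> 0" by metis
  then show ?thesis by (simp add: mps_var_def)
qed

lemma mps_coeff_sum: "mps_coeff (sum f I) m = (\<Sum>i\<in>I. mps_coeff (f i) m)"
  by (induction I rule: infinite_finite_induct) auto

definition mono_deg :: "('v \<Rightarrow>\<^sub>0 nat) \<Rightarrow> nat" where
  "mono_deg m = (\<Sum>v\<in>Poly_Mapping.keys m. Poly_Mapping.lookup m v)"

lemma mono_deg_superset:
  assumes "finite V" "Poly_Mapping.keys m \<subseteq> V"
  shows "mono_deg m = (\<Sum>v\<in>V. Poly_Mapping.lookup m v)"
  unfolding mono_deg_def using assms by (intro sum.mono_neutral_left) (auto simp: in_keys_iff)

lemma mono_deg_add: "mono_deg (a + b) = mono_deg a + mono_deg b"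
proof -
  let ?V = "Poly_Mapping.keys a \<union> Poly_Mapping.keys b"
  have "mono_deg (a + b) = (\<Sum>v\<in>?V. Poly_Mapping.lookup (a + b) v)"
    by (rule mono_deg_superset) (auto simp: Poly_Mapping.keys_add)
  also have "\<dots> = (\<Sum>v\<in>?V. Poly_Mapping.lookup a v) + (\<Sum>v\<in>?V. Poly_Mapping.lookup b v)"
    by (simp add: lookup_add sum.distrib)
  also have "\<dots> = mono_deg a + mono_deg b"
    by (simp add: mono_deg_superset[of ?V a] mono_deg_superset[of ?V b])
  finally show ?thesis .
qed

definition mps_order_ge :: "nat \<Rightarrow> ('v, 'a::comm_ring_1) mps \<Rightarrow> bool" where
  "mps_order_ge n f \<longleftrightarrow> (\<forall>m. mps_coeff f m \<noteq> 0 \<longrightarrow> n \<le> mono_deg m)"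

lemma mps_order_ge_0 [simp]: "mps_order_ge 0 f"
  by (simp add: mps_order_ge_def)

lemma mps_order_ge_mult:
  assumes "mps_order_ge a f" "mps_order_ge b g"
  shows "mps_order_ge (a + b) (f * g)"
  unfolding mps_order_ge_def
proof (intro allI impI)
  fix m assume "mps_coeff (f * g) m \<noteq> 0"
  then obtain p where p: "p \<in> mono_splits m" "mps_coeff f (fst p) * mps_coeff g (snd p) \<noteq> 0"
    by (auto simp: mps_coeff_mult case_prod_beta elim: sum.not_neutral_contains_not_neutral)
  then have "mps_coeff f (fst p) \<noteq> 0" "mps_coeff g (snd p) \<noteq> 0" by auto
  then have "a \<le> mono_deg (fst p)" "b \<le> mono_deg (snd p)"
    using assms by (auto simp: mps_order_ge_def)
  with p show "a + b \<le> mono_deg m"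
    by (auto simp: mono_splits_def mono_deg_add)
qed

lemma mps_order_ge_power:
  assumes "mps_order_ge a f"
  shows "mps_order_ge (n * a) (f ^ n)"
  by (induction n) (auto intro: mps_order_ge_mult assms)

lemma mps_order_ge_prod:
  assumes "\<And>i. i \<in> I \<Longrightarrow> mps_order_ge (a i) (f i)"
  shows "mps_order_ge (\<Sum>i\<in>I. a i) (\<Prod>i\<in>I. f i)"
  using assms by (induction I rule: infinite_finite_induct) (auto intro: mps_order_ge_mult)

lemma mps_order_ge_1:
  assumes "mps_coeff f 0 = 0"
  shows "mps_order_ge 1 f"
  unfolding mps_order_ge_def
proof (intro allI impI)
  fix m assume "mps_coeff f m \<noteq> 0"
  with assms have "m \<noteq> 0" by auto
  then obtain v where v: "v \<in> Poly_Mapping.keys m"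
    by (metis all_not_in_conv keys_eq_empty)
  then have "Poly_Mapping.lookup m v \<le> mono_deg m"
    unfolding mono_deg_def by (intro member_le_sum) auto
  with v show "1 \<le> mono_deg m"
    by (simp add: in_keys_iff)
qed

lemma mps_unit:
  fixes f :: "('v, 'a::comm_ring_1) mps"
  assumes "mps_coeff f 0 = 1"
  shows "f dvd 1"
proof -
  define h where "h = 1 - f"
  have ord: "mps_order_ge n (h ^ n)" for n
    using mps_order_ge_power[OF mps_order_ge_1, of h n] assms by (simp add: h_def)
  define G where "G = Abs_mps (\<lambda>m. \<Sum>n\<le>mono_deg m. mps_coeff (h ^ n) m)"
  have "f * G = 1"
  proof (rule mps_eqI)
    fix m :: "'v \<Rightarrow>\<^sub>0 nat"
    define D where "D = mono_deg m"
    have G: "mps_coeff G b = mps_coeff (\<Sum>n\<le>D. h ^ n) b" if "mono_deg b \<le> D" for b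
      unfolding G_def mps_coeff_sum mps_coeff_Abs
    proof (rule sum.mono_neutral_left)
      show "{..mono_deg b} \<subseteq> {..D}" using that by simp
      show "\<forall>n\<in>{..D} - {..mono_deg b}. mps_coeff (h ^ n) b = 0"
      proof
        fix n assume "n \<in> {..D} - {..mono_deg b}"
        then have "\<not> n \<le> mono_deg b" by simp
        then show "mps_coeff (h ^ n) b = 0"
          using ord[of n] unfolding mps_order_ge_def by blast
      qed
    qed simp
    have "mps_coeff (f * G) m = mps_coeff (f * (\<Sum>n\<le>D. h ^ n)) m"
      unfolding mps_coeff_mult
      by (rule sum.cong) (auto simp: mono_splits_def D_def mono_deg_add G)
    also have "f * (\<Sum>n\<le>D. h ^ n) = 1 - h ^ Suc D"
      using sum_gp_basic[of h D] by (simp add: h_def)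
    also have "mps_coeff (1 - h ^ Suc D) m = mps_coeff 1 m"
      using ord[of "Suc D"] by (auto simp: mps_order_ge_def D_def simp del: power_Suc)
    finally show "mps_coeff (f * G) m = mps_coeff 1 m" .
  qed
  then show ?thesis by (metis dvd_triv_left)
qed

lemma mps_mult_inverse:
  fixes f :: "('v, 'a::comm_ring_1) mps"
  assumes "f dvd 1"
  shows "f * inverse f = 1"
proof -
  from assms obtain g where g: "f * g = 1" by (metis dvdE)
  have "h = g" if "f * h = 1" for h
  proof -
    have "h = h * (f * g)" using g by simp
    also have "\<dots> = (f * h) * g" by (simp only: ac_simps)
    finally show ?thesis using that by simp
  qed
  with g have "(THE g. f * g = 1) = g" by (intro the_equality)
  with assms g show ?thesis by (simp add: inverse_mps_def)
qed

lemma mps_divide_mult_cancel: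
  fixes f g :: "('v, 'a::comm_ring_1) mps"
  assumes "mps_coeff g 0 = 1"
  shows "f / g * g = f"
  using mps_mult_inverse[OF mps_unit[OF assms]]
  by (simp add: divide_mps_def mult.assoc mult.commute[of "inverse g"])


section \<open>Word statistics and their generating function\<close>

definition ldes :: "nat set \<Rightarrow> nat list \<Rightarrow> nat" where
  "ldes X w = card {i. Suc i < length w \<and> w ! i > w ! Suc i \<and> w ! i \<in> X}"

definition lris :: "nat set \<Rightarrow> nat list \<Rightarrow> nat" where
  "lris X w = card {i. Suc i < length w \<and> w ! i < w ! Suc i \<and> w ! i \<in> X}"

definition lev :: "nat set \<Rightarrow> nat list \<Rightarrow> nat" where
  "lev X w = card {i. Suc i < length w \<and> w ! i = w ! Suc i \<and> w ! i \<in> X}"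

definition letters_in :: "nat set \<Rightarrow> nat list \<Rightarrow> nat" where
  "letters_in X w = card {i. i < length w \<and> w ! i \<in> X}"

text \<open>
  The variables \<open>x\<^sub>m, y\<^sub>m, z\<^sub>m, q\<^sub>m\<close>. Only those with \<open>1 \<le> m \<le> t\<close> occur below, so everything takes
  place in the subring of series in these \<open>4t\<close> variables.
\<close>

datatype stat_var = VX nat | VY nat | VZ nat | VQ nat

definition word_weight :: "nat \<Rightarrow> (nat \<Rightarrow> nat set) \<Rightarrow> nat list \<Rightarrow> (stat_var, 'a::comm_ring_1) mps" where
  "word_weight t N w =
     (\<Prod>m=1..t. mps_var (VX m) ^ ldes (N m) w * mps_var (VY m) ^ lris (N m) w *
                mps_var (VZ m) ^ lev (N m) w * mps_var (VQ m) ^ letters_in (N m) w)"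

definition A_gf :: "nat \<Rightarrow> (nat \<Rightarrow> nat set) \<Rightarrow> nat \<Rightarrow> (stat_var, 'a::comm_ring_1) mps" where
  "A_gf t N k = mps_suminf (word_weight t N) (lists {1..k})"

definition block_of :: "nat \<Rightarrow> (nat \<Rightarrow> nat set) \<Rightarrow> nat \<Rightarrow> nat" where
  "block_of t N i = (THE m. m \<in> {1..t} \<and> i \<in> N m)"

definition xv :: "nat \<Rightarrow> (nat \<Rightarrow> nat set) \<Rightarrow> nat \<Rightarrow> (stat_var, 'a::comm_ring_1) mps" where
  "xv t N i = mps_var (VX (block_of t N i))"

definition yv :: "nat \<Rightarrow> (nat \<Rightarrow> nat set) \<Rightarrow> nat \<Rightarrow> (stat_var, 'a::comm_ring_1) mps" where
  "yv t N i = mps_var (VY (block_of t N i))"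

definition zv :: "nat \<Rightarrow> (nat \<Rightarrow> nat set) \<Rightarrow> nat \<Rightarrow> (stat_var, 'a::comm_ring_1) mps" where
  "zv t N i = mps_var (VZ (block_of t N i))"

definition qv :: "nat \<Rightarrow> (nat \<Rightarrow> nat set) \<Rightarrow> nat \<Rightarrow> (stat_var, 'a::comm_ring_1) mps" where
  "qv t N i = mps_var (VQ (block_of t N i))"

definition gamma_coef ::
    "nat \<Rightarrow> (nat \<Rightarrow> nat set) \<Rightarrow> nat \<Rightarrow> nat \<Rightarrow> (stat_var, 'a::comm_ring_1) mps" where
  "gamma_coef t N k i =
     qv t N i * yv t N i / (1 - qv t N i * (zv t N i - yv t N i)) * A_gf t N k
     + qv t N i * (1 - yv t N i) / (1 - qv t N i * (zv t N i - yv t N i))"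

definition alpha_coef :: "nat \<Rightarrow> (nat \<Rightarrow> nat set) \<Rightarrow> nat \<Rightarrow> (stat_var, 'a::comm_ring_1) mps" where
  "alpha_coef t N i =
     qv t N i * (yv t N i - xv t N i) / (1 - qv t N i * (zv t N i - yv t N i))"

lemma block_of_eq:
  assumes "inj_on N {1..t}" "partition_on UNIV (N ` {1..t})" "m \<in> {1..t}" "i \<in> N m"
  shows "block_of t N i = m"
  unfolding block_of_def
proof (rule the_equality)
  show "m \<in> {1..t} \<and> i \<in> N m" using assms by simp
next
  fix m' assume m': "m' \<in> {1..t} \<and> i \<in> N m'"
  have "disjoint (N ` {1..t})" using assms(2) by (simp add: partition_on_def)
  then have "N m = N m'"
    using m' assms(3,4) unfolding disjoint_def by blast
  then show "m' = m" using assms(1,3) m' by (auto dest: inj_onD)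
qed

lemma sum_letters_in:
  fixes N :: "nat \<Rightarrow> nat set"
  assumes "inj_on N {1..t}" "partition_on UNIV (N ` {1..t})"
  shows "(\<Sum>m=1..t. letters_in (N m) w) = length w"
proof -
  have "(\<Sum>m=1..t. letters_in (N m) w) = card (\<Union>m\<in>{1..t}. {i. i < length w \<and> w ! i \<in> N m})"
    unfolding letters_in_def
  proof (rule card_UN_disjoint[symmetric])
    show "\<forall>m\<in>{1..t}. \<forall>m'\<in>{1..t}. m \<noteq> m' \<longrightarrow>
        {i. i < length w \<and> w ! i \<in> N m} \<inter> {i. i < length w \<and> w ! i \<in> N m'} = {}"
    proof (intro ballI impI)
      fix m m' assume "m \<in> {1..t}" "m' \<in> {1..t}" "m \<noteq> m'"
      then have "N m \<inter> N m' = {}"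
        by (metis block_of_eq[OF assms] disjoint_iff)
      then show "{i. i < length w \<and> w ! i \<in> N m} \<inter> {i. i < length w \<and> w ! i \<in> N m'} = {}"
        by blast
    qed
  qed auto
  also have "(\<Union>m\<in>{1..t}. {i. i < length w \<and> w ! i \<in> N m}) = {..<length w}"
    using assms(2) by (auto simp: partition_on_def)
  finally show ?thesis by simp
qed

lemma word_weight_summable:
  assumes "inj_on N {1..t}" "partition_on UNIV (N ` {1..t})"
  shows "mps_summable (word_weight t N :: _ \<Rightarrow> (stat_var, 'a::comm_ring_1) mps) (lists {1..k})"
  unfolding mps_summable_def
proof
  fix m
  have ord: "mps_order_ge (length w) (word_weight t N w :: (stat_var, 'a) mps)" for w
  proof -
    have "mps_order_ge (\<Sum>m=1..t. letters_in (N m) w) (word_weight t N w :: (stat_var, 'a) mps)"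
      unfolding word_weight_def
    proof (rule mps_order_ge_prod)
      fix m
      have "mps_order_ge (letters_in (N m) w) (mps_var (VQ m) ^ letters_in (N m) w :: (stat_var, 'a) mps)"
        using mps_order_ge_power[OF mps_order_ge_1, of "mps_var (VQ m)" "letters_in (N m) w"] by simp
      from mps_order_ge_mult[OF mps_order_ge_0 this]
      show "mps_order_ge (letters_in (N m) w)
         (mps_var (VX m) ^ ldes (N m) w * mps_var (VY m) ^ lris (N m) w *
          mps_var (VZ m) ^ lev (N m) w * mps_var (VQ m) ^ letters_in (N m) w :: (stat_var, 'a) mps)"
        by simp
    qed
    then show ?thesis by (simp only: sum_letters_in[OF assms])
  qed
  have "{w \<in> lists {1..k}. mps_coeff (word_weight t N w :: (stat_var, 'a) mps) m \<noteq> 0}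
        \<subseteq> {w. set w \<subseteq> {1..k} \<and> length w \<le> mono_deg m}"
    using ord by (auto simp: mps_order_ge_def)
  then show "finite {w \<in> lists {1..k}. mps_coeff (word_weight t N w :: (stat_var, 'a) mps) m \<noteq> 0}"
    by (rule finite_subset) (simp add: finite_lists_length_le)
qed

lemma stat_denominator_unit:
  "1 - qv t N i * (zv t N i - yv t N i) dvd (1 :: (stat_var, 'a::comm_ring_1) mps)"
  by (rule mps_unit) (simp add: qv_def)

end

theory Submission
  imports Defs
begin

text \<open>
  Let \<open>B\<^sub>i\<close> be the generating function of the words that start with the letter \<open>i\<close>. Removing the
  first letter gives \<open>B\<^sub>i = q\<^sub>i (1 + x\<^sub>i \<Sum>\<^sub>j\<^sub><\<^sub>i B\<^sub>j + z\<^sub>i B\<^sub>i + y\<^sub>i \<Sum>\<^sub>j\<^sub>>\<^sub>i B\<^sub>j)\<close>. Since \<open>A\<^sub>k = 1 + \<Sum>\<^sub>j B\<^sub>j\<close>, the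
  sum over \<open>j > i\<close> can be eliminated, and the partial sums \<open>S\<^sub>i = B\<^sub>1 + \<dots> + B\<^sub>i\<close> satisfy the
  first-order recurrence \<open>S\<^sub>i = (1 - \<alpha>\<^sub>i) S\<^sub>i\<^sub>-\<^sub>1 + \<gamma>\<^sub>i\<close>, whose solution is the first formula. The
  \<open>\<gamma>\<^sub>i\<close> are affine in \<open>A\<^sub>k\<close>, and solving for \<open>A\<^sub>k\<close> gives the second one.
\<close>

section \<open>Formal sums\<close>

text \<open>Terms outside the support contribute 0, so any finite set containing the support will
  do; this lets several formal sums be compared over one common index set.\<close>

lemma mps_coeff_suminf_superset:
  assumes "finite F" "F \<subseteq> I" "\<And>i. i \<in> I \<Longrightarrow> mps_coeff (f i) m \<noteq> 0 \<Longrightarrow> i \<in> F"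
  shows "mps_coeff (mps_suminf f I) m = (\<Sum>i\<in>F. mps_coeff (f i) m)"
  unfolding mps_suminf_def mps_coeff_Abs
  using assms by (intro sum.mono_neutral_left) auto

lemma mps_suminf_mult_left:
  assumes "mps_summable f I"
  shows "mps_suminf (\<lambda>i. c * f i) I = c * mps_suminf f I"
proof (rule mps_eqI)
  fix m
  \<comment> \<open>\<open>F\<close> collects every index that matters for some right factor of
    \<open>m\<close>. As \<open>m\<close> has finitely many splittings, \<open>F\<close> is finite
    and serves all of them, so the two sums can be swapped.\<close>
  define F where "F = (\<Union>p\<in>mono_splits m. {i \<in> I. mps_coeff (f i) (snd p) \<noteq> 0})"
  have F: "finite F" "F \<subseteq> I"
    using assms by (auto simp: F_def mps_summable_def)
  have "mps_coeff (mps_suminf (\<lambda>i. c * f i) I) m = (\<Sum>i\<in>F. mps_coeff (c * f i) m)"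
  proof (rule mps_coeff_suminf_superset[OF F])
    fix i assume "i \<in> I" "mps_coeff (c * f i) m \<noteq> 0"
    then obtain p where "p \<in> mono_splits m" "mps_coeff c (fst p) * mps_coeff (f i) (snd p) \<noteq> 0"
      by (auto simp: mps_coeff_mult case_prod_beta elim: sum.not_neutral_contains_not_neutral)
    then have "mps_coeff (f i) (snd p) \<noteq> 0" by auto
    then show "i \<in> F" using \<open>i \<in> I\<close> \<open>p \<in> mono_splits m\<close> by (auto simp: F_def)
  qed
  also have "\<dots> = (\<Sum>p\<in>mono_splits m. \<Sum>i\<in>F. mps_coeff c (fst p) * mps_coeff (f i) (snd p))"
    by (simp add: mps_coeff_mult case_prod_beta sum.swap[of _ F])
  also have "\<dots> = (\<Sum>p\<in>mono_splits m. mps_coeff c (fst p) * mps_coeff (mps_suminf f I) (snd p))"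
  proof (rule sum.cong[OF refl])
    fix p assume "p \<in> mono_splits m"
    then have "mps_coeff (mps_suminf f I) (snd p) = (\<Sum>i\<in>F. mps_coeff (f i) (snd p))"
      by (intro mps_coeff_suminf_superset[OF F]) (auto simp: F_def)
    then show "(\<Sum>i\<in>F. mps_coeff c (fst p) * mps_coeff (f i) (snd p)) =
        mps_coeff c (fst p) * mps_coeff (mps_suminf f I) (snd p)"
      by (simp add: sum_distrib_left)
  qed
  also have "\<dots> = mps_coeff (c * mps_suminf f I) m"
    by (simp add: mps_coeff_mult case_prod_beta)
  finally show "mps_coeff (mps_suminf (\<lambda>i. c * f i) I) m = mps_coeff (c * mps_suminf f I) m" .
qed

lemma mps_summable_Cons:
  assumes "mps_summable f (lists S)" "i \<in> S"
  shows "mps_summable (\<lambda>w. f (i # w)) (lists S)"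
  unfolding mps_summable_def
proof
  fix m
  have "finite ((#) i ` {w \<in> lists S. mps_coeff (f (i # w)) m \<noteq> 0})"
    using assms(1)[unfolded mps_summable_def, rule_format, of m]
    by (rule finite_subset[rotated]) (use assms(2) in auto)
  then show "finite {w \<in> lists S. mps_coeff (f (i # w)) m \<noteq> 0}"
    by (rule finite_imageD) simp
qed

text \<open>A word is either empty or has a unique first letter, so \<open>lists S\<close> is the
  disjoint union of \<open>{[]}\<close> and the injective images of itself under
  \<open>(#) i\<close>.\<close>

lemma mps_suminf_lists:
  assumes "mps_summable f (lists S)" "finite S"
  shows "mps_suminf f (lists S) = f [] + (\<Sum>i\<in>S. mps_suminf (\<lambda>w. f (i # w)) (lists S))"
proof (rule mps_eqI)
  fix m
  define G where "G i = {w \<in> lists S. mps_coeff (f (i # w)) m \<noteq> 0}" for i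
  have G: "finite (G i)" if "i \<in> S" for i
    using mps_summable_Cons[OF assms(1) that] by (simp add: G_def mps_summable_def)
  have "mps_coeff (mps_suminf f (lists S)) m =
      (\<Sum>w\<in>insert [] (\<Union>i\<in>S. (#) i ` G i). mps_coeff (f w) m)"
  proof (rule mps_coeff_suminf_superset)
    fix w assume "w \<in> lists S" "mps_coeff (f w) m \<noteq> 0"
    then show "w \<in> insert [] (\<Union>i\<in>S. (#) i ` G i)"
      by (cases w) (auto simp: G_def)
  qed (use G assms(2) in \<open>auto simp: G_def\<close>)
  also have "\<dots> = mps_coeff (f []) m + (\<Sum>w\<in>(\<Union>i\<in>S. (#) i ` G i). mps_coeff (f w) m)"
    using G assms(2) by (subst sum.insert) auto
  also have "(\<Sum>w\<in>(\<Union>i\<in>S. (#) i ` G i). mps_coeff (f w) m) =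
      (\<Sum>i\<in>S. \<Sum>w\<in>(#) i ` G i. mps_coeff (f w) m)"
    using G assms(2) by (intro sum.UNION_disjoint) auto
  also have "\<dots> = (\<Sum>i\<in>S. mps_coeff (mps_suminf (\<lambda>w. f (i # w)) (lists S)) m)"
    by (intro sum.cong refl) (simp add: sum.reindex mps_suminf_def G_def)
  finally show "mps_coeff (mps_suminf f (lists S)) m =
      mps_coeff (f [] + (\<Sum>i\<in>S. mps_suminf (\<lambda>w. f (i # w)) (lists S))) m"
    by (simp add: mps_coeff_sum)
qed

section \<open>Removing the first letter of a word\<close>

text \<open>Prepending a letter creates the new position 0 and moves every old position up by
  one.\<close>

lemma card_shift:
  assumes "finite {i. P i}"
  shows "card {i. P i} = of_bool (P 0) + card {i. P (Suc i)}"
proof -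
  have eq: "{i. P i} = (if P 0 then {0} else {}) \<union> Suc ` {i. P (Suc i)}"
    by (auto simp: image_iff) (metis not0_implies_Suc)+
  have "finite (Suc ` {i. P (Suc i)})"
    using assms by (rule finite_subset[rotated]) auto
  then have "card ((if P 0 then {0} else {}) \<union> Suc ` {i. P (Suc i)}) =
      of_bool (P 0) + card (Suc ` {i. P (Suc i)})"
    by (subst card_Un_disjoint) auto
  then show ?thesis
    using eq by (simp add: card_image)
qed

lemma ldes_Cons_Cons: "ldes X (i # j # w) = of_bool (i \<in> X \<and> i > j) + ldes X (j # w)"
  unfolding ldes_def by (subst card_shift) auto

lemma lris_Cons_Cons: "lris X (i # j # w) = of_bool (i \<in> X \<and> i < j) + lris X (j # w)"
  unfolding lris_def by (subst card_shift) auto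

lemma lev_Cons_Cons: "lev X (i # j # w) = of_bool (i \<in> X \<and> i = j) + lev X (j # w)"
  unfolding lev_def by (subst card_shift) auto

lemma letters_in_Cons: "letters_in X (i # w) = of_bool (i \<in> X) + letters_in X w"
  unfolding letters_in_def by (subst card_shift) auto

lemma statistics_Nil [simp]:
  "ldes X [] = 0" "lris X [] = 0" "lev X [] = 0" "letters_in X [] = 0"
  by (simp_all add: ldes_def lris_def lev_def letters_in_def)

lemma statistics_singleton [simp]:
  "ldes X [i] = 0" "lris X [i] = 0" "lev X [i] = 0"
  by (simp_all add: ldes_def lris_def lev_def)

lemma word_weight_Nil [simp]: "word_weight t N [] = 1"
  by (simp add: word_weight_def)

text \<open>The factor contributed by an adjacent pair \<open>i\<close>, \<open>j\<close>. Its
  variable is taken from the block of \<open>i\<close> because all three statistics test the left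
  letter for membership.\<close>

definition step_weight ::
    "nat \<Rightarrow> (nat \<Rightarrow> nat set) \<Rightarrow> nat \<Rightarrow> nat \<Rightarrow> (stat_var, 'a::comm_ring_1) mps" where
  "step_weight t N i j = (if j < i then xv t N i else if i < j then yv t N i else zv t N i)"

text \<open>A letter lies in exactly one block \<open>b\<close>, so a new occurrence changes the
  factor at \<open>b\<close> only; \<open>c\<close> is the comparison that decides whether it is
  counted.\<close>

lemma prod_power_of_bool_add:
  fixes v :: "'i \<Rightarrow> 'a::comm_monoid_mult"
  assumes "finite S" "b \<in> S" "\<And>m. m \<in> S \<Longrightarrow> P m \<longleftrightarrow> m = b \<and> c"
  shows "(\<Prod>m\<in>S. v m ^ (of_bool (P m) + e m)) = (if c then v b else 1) * (\<Prod>m\<in>S. v m ^ e m)"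
proof -
  have "(\<Prod>m\<in>S. v m ^ (of_bool (P m) + e m)) =
      (\<Prod>m\<in>S. (if m = b then (if c then v b else 1) else 1) * v m ^ e m)"
    using assms(3) by (intro prod.cong refl) auto
  also have "\<dots> = (if c then v b else 1) * (\<Prod>m\<in>S. v m ^ e m)"
    using assms(1,2) by (simp add: prod.distrib prod.delta)
  finally show ?thesis .
qed

context
  fixes t :: nat and N :: "nat \<Rightarrow> nat set"
  assumes inj: "inj_on N {1..t}" and part: "partition_on UNIV (N ` {1..t})"
begin

lemma block_of_mem: "block_of t N i \<in> {1..t}"
  and mem_block_iff: "m \<in> {1..t} \<Longrightarrow> i \<in> N m \<longleftrightarrow> m = block_of t N i"
proof -
  have "i \<in> \<Union> (N ` {1..t})" using part by (simp add: partition_on_def)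
  then show "block_of t N i \<in> {1..t}" "m \<in> {1..t} \<Longrightarrow> i \<in> N m \<longleftrightarrow> m = block_of t N i"
    using block_of_eq[OF inj part] by blast+
qed

lemma word_weight_singleton: "word_weight t N [i] = qv t N i"
proof -
  have "word_weight t N [i] =
      (\<Prod>m=1..t. mps_var (VQ m) ^ (of_bool (i \<in> N m) + 0))"
    by (simp add: word_weight_def letters_in_Cons)
  also have "\<dots> = qv t N i"
    by (subst prod_power_of_bool_add[where b = "block_of t N i" and c = True])
       (use block_of_mem mem_block_iff in \<open>auto simp: qv_def\<close>)
  finally show ?thesis .
qed

lemma word_weight_Cons_Cons:
  "word_weight t N (i # j # w) = qv t N i * step_weight t N i j * word_weight t N (j # w)"
proof -
  have shift: "(\<Prod>m=1..t. mps_var (V m) ^ (of_bool (i \<in> N m \<and> c) + e m)) =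
      (if c then mps_var (V (block_of t N i)) else 1) * (\<Prod>m=1..t. mps_var (V m) ^ e m)"
    for V :: "nat \<Rightarrow> stat_var" and c :: bool and e :: "nat \<Rightarrow> nat"
    by (rule prod_power_of_bool_add) (use block_of_mem mem_block_iff in auto)
  \<comment> \<open>Counting letters involves no comparison, hence the instance without
    \<open>c\<close>.\<close>
  note shift_True = shift[of _ True, unfolded simp_thms if_True]
  have "word_weight t N (i # j # w) =
      (if j < i then xv t N i else 1) * (if i < j then yv t N i else 1) *
      (if i = j then zv t N i else 1) * qv t N i * word_weight t N (j # w)"
    unfolding word_weight_def ldes_Cons_Cons lris_Cons_Cons lev_Cons_Cons
      letters_in_Cons[of _ i] prod.distrib shift shift_True xv_def yv_def zv_def qv_def
    by (simp only: ac_simps)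
  then show ?thesis
    by (auto simp: step_weight_def ac_simps)
qed

definition first_letter_gf :: "nat \<Rightarrow> nat \<Rightarrow> (stat_var, 'a::comm_ring_1) mps" where
  "first_letter_gf k i = mps_suminf (\<lambda>w. word_weight t N (i # w)) (lists {1..k})"

lemma A_gf_first_letter:
  "(A_gf t N k :: (stat_var, 'a::comm_ring_1) mps) = 1 + (\<Sum>i=1..k. first_letter_gf k i)"
  unfolding A_gf_def first_letter_gf_def
  using mps_suminf_lists[OF word_weight_summable[OF inj part]] by simp

text \<open>Split by the second letter \<open>j\<close>: the word \<open>[i]\<close> gives the
  summand 1, and \<open>word_weight_Cons_Cons\<close> pulls a factor independent of the remaining
  word out of each formal sum.\<close>

lemma first_letter_gf_rec:
  assumes "i \<in> {1..k}"
  shows "(first_letter_gf k i :: (stat_var, 'a::comm_ring_1) mps) =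
    qv t N i * (1 + (\<Sum>j=1..k. step_weight t N i j * first_letter_gf k j))"
proof -
  note summable = mps_summable_Cons[OF word_weight_summable[OF inj part]]
  have "(first_letter_gf k i :: (stat_var, 'a) mps) = qv t N i +
      (\<Sum>j=1..k. mps_suminf (\<lambda>w. qv t N i * step_weight t N i j * word_weight t N (j # w)) (lists {1..k}))"
    unfolding first_letter_gf_def
    using mps_suminf_lists[OF summable[OF assms]]
    by (simp add: word_weight_singleton word_weight_Cons_Cons)
  also have "\<dots> = qv t N i + (\<Sum>j=1..k. qv t N i * step_weight t N i j * first_letter_gf k j)"
    unfolding first_letter_gf_def
    by (intro arg_cong2[where f = "(+)"] sum.cong refl mps_suminf_mult_left[OF summable])
  finally show ?thesis
    by (simp add: sum_distrib_left distrib_left mult.assoc)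
qed

section \<open>The recurrence for partial sums\<close>

lemma first_letter_gf_eq:
  assumes "i \<in> {1..k}"
  shows "(first_letter_gf k i :: (stat_var, 'a::comm_ring_1) mps) =
    gamma_coef t N k i - alpha_coef t N i * (\<Sum>j=1..i-1. first_letter_gf k j)"
proof -
  define B :: "nat \<Rightarrow> (stat_var, 'a) mps" where "B = first_letter_gf k"
  define x y z q A :: "(stat_var, 'a) mps"
    where "x = xv t N i" and "y = yv t N i" and "z = zv t N i" and "q = qv t N i"
      and "A = A_gf t N k"
  define L R where "L = (\<Sum>j=1..i-1. B j)" and "R = (\<Sum>j=i+1..k. B j)"
  define d where "d = 1 - q * (z - y)"
  have split: "(\<Sum>j=1..k. f j) = (\<Sum>j=1..i-1. f j) + f i + (\<Sum>j=i+1..k. f j)"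
    for f :: "nat \<Rightarrow> (stat_var, 'a) mps"
  proof -
    have "{1..k} = {1..i-1} \<union> insert i {i+1..k}" using assms by auto
    then have "(\<Sum>j=1..k. f j) = (\<Sum>j\<in>{1..i-1} \<union> insert i {i+1..k}. f j)" by simp
    also have "\<dots> = (\<Sum>j=1..i-1. f j) + f i + (\<Sum>j=i+1..k. f j)"
      using assms by (subst sum.union_disjoint) (auto simp: add.assoc)
    finally show ?thesis .
  qed
  have "A = 1 + L + B i + R"
    unfolding A_def L_def R_def A_gf_first_letter B_def[symmetric] split[of B] by (simp add: add.assoc)
  then have R: "R = A - 1 - L - B i" by simp
  have "(\<Sum>j=1..k. step_weight t N i j * B j) = x * L + z * B i + y * R"
    unfolding split L_def R_def sum_distrib_left
    by (intro arg_cong2[where f = "(+)"] sum.cong)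
       (use assms in \<open>auto simp: step_weight_def x_def y_def z_def\<close>)
  then have "B i = q * (1 + x * L + z * B i + y * R)"
    using first_letter_gf_rec[OF assms, where 'a = 'a] by (simp add: B_def q_def add.assoc)
  \<comment> \<open>Substituting for \<open>R\<close> leaves \<open>B i\<close> with coefficient
    \<open>q * (z - y)\<close> on the right; moving it to the left produces
    \<open>d\<close>.\<close>
  then have Bd: "B i * d = q * y * A + q * (1 - y) - q * (y - x) * L"
    unfolding R d_def by (simp add: algebra_simps)
  have d: "d * inverse d = 1"
    using mps_mult_inverse[OF stat_denominator_unit] by (simp add: d_def q_def z_def y_def)
  \<comment> \<open>The coefficient ring may have zero divisors, so \<open>d\<close> is removed by
    multiplying with its inverse.\<close>
  have "B i = B i * d * inverse d"
    by (simp add: mult.assoc d)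
  also have "\<dots> = q * y / d * A + q * (1 - y) / d - q * (y - x) / d * L"
    unfolding Bd divide_mps_def by (simp add: algebra_simps)
  finally show ?thesis
    by (simp add: gamma_coef_def alpha_coef_def B_def x_def y_def z_def q_def A_def L_def d_def)
qed

text \<open>The induction is on the cut-off \<open>n\<close> with \<open>k\<close> fixed, since
  \<open>gamma_coef\<close> contains the series for the full alphabet.\<close>

lemma sum_first_letter_gf:
  assumes "n \<le> k"
  shows "(\<Sum>j=1..n. first_letter_gf k j :: (stat_var, 'a::comm_ring_1) mps) =
    (\<Sum>j=1..n. gamma_coef t N k j * (\<Prod>i=j+1..n. 1 - alpha_coef t N i))"
  using assms
proof (induction n)
  case 0
  then show ?case by simp
next
  case (Suc n)
  let ?S = "\<Sum>j=1..n. first_letter_gf k j :: (stat_var, 'a) mps"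
  let ?\<alpha> = "alpha_coef t N (Suc n) :: (stat_var, 'a) mps"
  have "(\<Sum>j=1..Suc n. first_letter_gf k j :: (stat_var, 'a) mps) =
      ?S * (1 - ?\<alpha>) + gamma_coef t N k (Suc n)"
    using first_letter_gf_eq[of "Suc n" k, where 'a = 'a] Suc.prems
    by (simp add: algebra_simps)
  also have "?S = (\<Sum>j=1..n. gamma_coef t N k j * (\<Prod>i=j+1..n. 1 - alpha_coef t N i))"
    using Suc by simp
  \<comment> \<open>The new factor extends each product by \<open>i = Suc n\<close>; the summand
    \<open>j = Suc n\<close> then carries an empty product.\<close>
  also have "\<dots> * (1 - ?\<alpha>) =
      (\<Sum>j=1..n. gamma_coef t N k j * (\<Prod>i=j+1..Suc n. 1 - alpha_coef t N i))"
    unfolding sum_distrib_right by (intro sum.cong refl) (simp add: mult.assoc)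
  finally show ?case by simp
qed

lemma A_gf_eq_sum_gamma:
  "(A_gf t N k :: (stat_var, 'a::comm_ring_1) mps) =
    1 + (\<Sum>j=1..k. gamma_coef t N k j * (\<Prod>i=j+1..k. 1 - alpha_coef t N i))"
  using sum_first_letter_gf[of k k, where 'a = 'a] by (simp add: A_gf_first_letter)

end

section \<open>Solving the affine equation for the generating function\<close>

lemma one_minus_alpha_coef:
  "1 - alpha_coef t N i =
    (1 - qv t N i * (zv t N i - xv t N i)) / (1 - qv t N i * (zv t N i - yv t N i))"
proof -
  define d :: "(stat_var, 'a) mps" where "d = 1 - qv t N i * (zv t N i - yv t N i)"
  have "d * inverse d = 1"
    using mps_mult_inverse[OF stat_denominator_unit] by (simp add: d_def)
  then have "1 - alpha_coef t N i = (d - qv t N i * (yv t N i - xv t N i)) * inverse d"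
    by (simp add: alpha_coef_def divide_mps_def left_diff_distrib flip: d_def)
  also have "d - qv t N i * (yv t N i - xv t N i) = 1 - qv t N i * (zv t N i - xv t N i)"
    by (simp add: d_def algebra_simps)
  finally show ?thesis by (simp add: divide_mps_def d_def)
qed

lemma mps_eq_divideI:
  fixes f g h :: "('v, 'a::comm_ring_1) mps"
  assumes "mps_coeff g 0 = 1" "f * g = h"
  shows "f = h / g"
  using mps_mult_inverse[OF mps_unit[OF assms(1)]] assms(2)
  by (metis divide_mps_def mult.assoc mult.right_neutral)

theorem theorem2p3:
  fixes k t :: nat and N :: "nat \<Rightarrow> nat set"
  assumes "k \<ge> 1"
    and "inj_on N {1..t}"
    and "partition_on UNIV (N ` {1..t})"
  shows "(A_gf t N k :: (stat_var, 'a::comm_ring_1) mps) =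
           1 + (\<Sum>j=1..k. gamma_coef t N k j * (\<Prod>i=j+1..k. 1 - alpha_coef t N i))
       \<and> (A_gf t N k :: (stat_var, 'a) mps) =
           (1 + (\<Sum>j=1..k. qv t N j * (1 - yv t N j) / (1 - qv t N j * (zv t N j - yv t N j)) *
                  (\<Prod>i=j+1..k. (1 - qv t N i * (zv t N i - xv t N i)) /
                                (1 - qv t N i * (zv t N i - yv t N i))))) /
           (1 - (\<Sum>j=1..k. qv t N j * yv t N j / (1 - qv t N j * (zv t N j - yv t N j)) *
                  (\<Prod>i=j+1..k. (1 - qv t N i * (zv t N i - xv t N i)) /
                                (1 - qv t N i * (zv t N i - yv t N i)))))"
    (is "_ \<and> _ = (1 + (\<Sum>j=1..k. ?u j * ?P j)) / (1 - (\<Sum>j=1..k. ?v j * ?P j))")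
proof (intro conjI mps_eq_divideI)
  let ?A = "A_gf t N k :: (stat_var, 'a) mps"
  show A: "?A = 1 + (\<Sum>j=1..k. gamma_coef t N k j * (\<Prod>i=j+1..k. 1 - alpha_coef t N i))"
    using assms(2,3) by (rule A_gf_eq_sum_gamma)
  \<comment> \<open>Each \<open>gamma_coef\<close> is split into its multiple of \<open>?A\<close>
    and its part free of \<open>?A\<close>.\<close>
  have "?A = 1 + (\<Sum>j=1..k. ?v j * ?P j) * ?A + (\<Sum>j=1..k. ?u j * ?P j)"
    by (subst A) (simp add: one_minus_alpha_coef gamma_coef_def sum.distrib sum_distrib_left
        distrib_right mult.assoc mult.commute[of _ ?A] mult.left_commute[of _ ?A] add.assoc)
  then show "?A * (1 - (\<Sum>j=1..k. ?v j * ?P j)) = 1 + (\<Sum>j=1..k. ?u j * ?P j)"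
    by (simp add: algebra_simps)
  \<comment> \<open>Every \<open>?v j\<close> has the factor \<open>qv t N j\<close>, whose constant
    coefficient is 0, so the denominator is a unit.\<close>
  show "mps_coeff (1 - (\<Sum>j=1..k. ?v j * ?P j)) 0 = 1"
    by (simp add: mps_coeff_sum divide_mps_def qv_def)
qed

end
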